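(* Let $\lambda$ be an essentially regular point, let $H_0\in\mathcal A$ be an operator regular at $\lambda$, let $V=F^*JF\in\mathcal A_0(F)$, let $r_\lambda$ be a real resonance point of the triple $(\lambda;H_0,V)$ and let $r$ be a regular point of the triple $(\lambda;H_0,V)$. If $\lambda$ is an eigenvalue of the operator $H_{r_\lambda}=H_0+r_\lambda V$ with eigenvector $\chi\in\mathcal D=\operatorname{dom}(H_0)$, then the vector $u=F\chi$ is a resonance vector of order $1$, that is, $$\bigl(1+(r_\lambda-r)T_{\lambda+i0}(H_r)J\bigr)u=0 .$$
   Context: Setting. $\mathcal H,\mathcal K$ are complex separable Hilbert spaces. $F:\mathcal H\to\mathcal K$ is a closed densely defined operator with trivial kernel and co-kernel (the rigging operator). $\mathcal A_0(F)$ is a real vector space of self-adjoint operators $V$ on $\mathcal H$ of the form $V=F^*JF$, where $J$ runs over a real subspace of the bounded self-adjoint operators on $\mathcal K$, and $\mathcal A=H+\mathcal A_0(F)$ is an affine space of self-adjoint operators on $\mathcal H$. Write $R_z(H)=(H-z)^{-1}$. Standing assumptions: all $H\in\mathcal A$ have a common dense domain $\mathcal D$; $\mathcal D\subset\operatorname{dom}(F)$ and $\mathcal D\subset\operatorname{dom}(V)$ for all $V\in\mathcal A_0(F)$; every $V\in\mathcal A_0(F)$ is relatively compact with respect to every $H\in\mathcal A$; and for non-real $z$ the operator $T_z(H):=FR_z(H)F^*$ (densely defined on $\operatorname{dom}F^*$) extends to a compact operator on $\mathcal K$, also denoted $T_z(H)$. $\Lambda(H,F)$ is the set of real $\lambda$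 for which the norm limit $T_{\lambda+i0}(H):=\lim_{y\to0^+}T_{\lambda+iy}(H)$ exists; it is assumed to have full Lebesgue measure for every $H\in\mathcal A$ (limiting absorption principle). Elements of $\Lambda(\mathcal A,F):=\bigcup_{H\in\mathcal A}\Lambda(H,F)$ are called essentially regular. For an essentially regular $\lambda$, $H\in\mathcal A$ is regular at $\lambda$ if $\lambda\in\Lambda(H,F)$ and resonant at $\lambda$ otherwise. With $H_r=H_0+rV$, a real number $r$ is a regular (non-resonant) point of the triple $(\lambda;H_0,V)$ if $H_r$ is regular at $\lambda$, and a resonance point otherwise. *)

theory Defs
  imports "HOL-Analysis.Analysis"
begin

section \<open>Complex Hilbert spaces\<close>

text \<open>The inner product is antilinear in the first and linear in the second argument. Positivity
  and definiteness follow from the norm axioms of \<^class>\<open>real_normed_vector\<close>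
  and the identity \<open>norm_eq_sqrt_cinner\<close>, because \<^const>\<open>sqrt\<close> is negative on negative reals.\<close>

class complex_inner = real_normed_vector +
  fixes scaleC :: "complex \<Rightarrow> 'a \<Rightarrow> 'a" (infixr "*\<^sub>C" 75)
    and cinner :: "'a \<Rightarrow> 'a \<Rightarrow> complex"
  assumes scaleC_add_right: "a *\<^sub>C (x + y) = a *\<^sub>C x + a *\<^sub>C y"
    and scaleC_add_left: "(a + b) *\<^sub>C x = a *\<^sub>C x + b *\<^sub>C x"
    and scaleC_scaleC: "a *\<^sub>C b *\<^sub>C x = (a * b) *\<^sub>C x"
    and scaleR_scaleC: "r *\<^sub>R x = complex_of_real r *\<^sub>C x"
    and cinner_commute: "cinner x y = cnj (cinner y x)"
    and cinner_add_right: "cinner x (y + z) = cinner x y + cinner x z"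
    and cinner_scaleC_right: "cinner x (a *\<^sub>C y) = a * cinner x y"
    and norm_eq_sqrt_cinner: "norm x = sqrt (Re (cinner x x))"

class chilbert_space = complex_inner + complete_space

instantiation complex :: chilbert_space
begin

definition scaleC_complex :: "complex \<Rightarrow> complex \<Rightarrow> complex"
  where "scaleC_complex a x = a * x"

definition cinner_complex :: "complex \<Rightarrow> complex \<Rightarrow> complex"
  where "cinner_complex x y = cnj x * y"

instance
  by standard
    (simp_all add: scaleC_complex_def cinner_complex_def algebra_simps scaleR_conv_of_real
      cmod_def power2_eq_square)

end

section \<open>Unbounded operators\<close>

text \<open>A (possibly unbounded, possibly only partially defined) operator is represented by its graph,
  so that equality of operators includes equality of domains and \<open>\<subseteq>\<close> means extension.
  Sums, products and inverses have their natural domains; the inverse is \<^const>\<open>converse\<close>.\<close>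

type_synonym ('a, 'b) graph = "('a \<times> 'b) set"

definition linear_operator :: "('a::complex_inner, 'b::complex_inner) graph \<Rightarrow> bool"
  where "linear_operator A \<longleftrightarrow>
    (0, 0) \<in> A \<and>
    (\<forall>x y x' y'. (x, y) \<in> A \<longrightarrow> (x', y') \<in> A \<longrightarrow> (x + x', y + y') \<in> A) \<and>
    (\<forall>c x y. (x, y) \<in> A \<longrightarrow> (c *\<^sub>C x, c *\<^sub>C y) \<in> A) \<and>
    single_valued A"

definition densely_defined :: "('a::complex_inner, 'b::complex_inner) graph \<Rightarrow> bool"
  where "densely_defined A \<longleftrightarrow> closure (Domain A) = UNIV"

definition kernel :: "('a::complex_inner, 'b::complex_inner) graph \<Rightarrow> 'a set"
  where "kernel A = {x. (x, 0) \<in> A}"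

definition op_plus :: "('a::complex_inner, 'b::complex_inner) graph \<Rightarrow> ('a, 'b) graph \<Rightarrow> ('a, 'b) graph"
    (infixl "+\<^sub>o" 65)
  where "A +\<^sub>o B = {(x, y + z) | x y z. (x, y) \<in> A \<and> (x, z) \<in> B}"

definition op_scale :: "complex \<Rightarrow> ('a::complex_inner, 'b::complex_inner) graph \<Rightarrow> ('a, 'b) graph"
    (infixr "*\<^sub>o" 75)
  where "c *\<^sub>o A = {(x, c *\<^sub>C y) | x y. (x, y) \<in> A}"

abbreviation op_comp :: "('b, 'c) graph \<Rightarrow> ('a, 'b) graph \<Rightarrow> ('a, 'c) graph"
    (infixr "\<circ>\<^sub>o" 70)
  where "B \<circ>\<^sub>o A \<equiv> A O B"

definition graph_of :: "('a::complex_inner \<Rightarrow>\<^sub>L 'b::complex_inner) \<Rightarrow> ('a, 'b) graph"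
  where "graph_of T = {(x, blinfun_apply T x) | x. True}"

definition adj :: "('a::complex_inner, 'b::complex_inner) graph \<Rightarrow> ('b, 'a) graph"
  where "adj A = {(y, z). \<forall>(x, w) \<in> A. cinner w y = cinner x z}"

definition self_adjoint :: "('a::complex_inner, 'a) graph \<Rightarrow> bool"
  where "self_adjoint A \<longleftrightarrow> linear_operator A \<and> densely_defined A \<and> adj A = A"

definition resolvent :: "('a::complex_inner, 'a) graph \<Rightarrow> complex \<Rightarrow> ('a, 'a) graph"
  where "resolvent H z = (H +\<^sub>o (- z) *\<^sub>o Id)\<inverse>"

definition eigenvector :: "('a::complex_inner, 'a) graph \<Rightarrow> complex \<Rightarrow> 'a \<Rightarrow> bool"
  where "eigenvector H c x \<longleftrightarrow> x \<noteq> 0 \<and> (x, c *\<^sub>C x) \<in> H"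

section \<open>Bounded and compact operators\<close>

text \<open>Elements of \<open>'a \<Rightarrow>\<^sub>L 'b\<close> are only real-linear, hence the predicate \<open>complex_linear\<close>; the
  norm of that type is the operator norm.\<close>

definition complex_linear :: "('a::complex_inner \<Rightarrow>\<^sub>L 'b::complex_inner) \<Rightarrow> bool"
  where "complex_linear T \<longleftrightarrow>
    (\<forall>c x. blinfun_apply T (c *\<^sub>C x) = c *\<^sub>C blinfun_apply T x)"

definition bounded_self_adjoint :: "('a::complex_inner \<Rightarrow>\<^sub>L 'a) \<Rightarrow> bool"
  where "bounded_self_adjoint J \<longleftrightarrow> complex_linear J \<and>
    (\<forall>x y. cinner (blinfun_apply J x) y = cinner x (blinfun_apply J y))"

definition compact_operator :: "('a::complex_inner \<Rightarrow>\<^sub>L 'b::complex_inner) \<Rightarrow> bool"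
  where "compact_operator T \<longleftrightarrow> complex_linear T \<and> compact (closure (blinfun_apply T ` cball 0 1))"

definition relatively_compact :: "('a::complex_inner, 'a) graph \<Rightarrow> ('a, 'a) graph \<Rightarrow> bool"
  where "relatively_compact V H \<longleftrightarrow> Domain H \<subseteq> Domain V \<and>
    (\<forall>z. Im z \<noteq> 0 \<longrightarrow> (\<exists>C. compact_operator C \<and> V \<circ>\<^sub>o resolvent H z = graph_of C))"

section \<open>The rigging operator and the sandwiched resolvent\<close>

definition sandwich :: "('h::complex_inner, 'k::complex_inner) graph \<Rightarrow> ('k \<Rightarrow>\<^sub>L 'k) \<Rightarrow> ('h, 'h) graph"
  where "sandwich F J = adj F \<circ>\<^sub>o graph_of J \<circ>\<^sub>o F"

text \<open>The self-adjoint operator written \<open>V = F\<^sup>*JF\<close>. The closure is needed for unbounded \<open>F\<close>: for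
  \<open>J = 0\<close> the product with its natural domain is the zero operator on \<open>dom F\<close>, which is not
  self-adjoint unless \<open>dom F\<close> is the whole space. When the product itself is self-adjoint it is
  closed, and the closure changes nothing.\<close>

definition perturbation :: "('h::complex_inner, 'k::complex_inner) graph \<Rightarrow> ('k \<Rightarrow>\<^sub>L 'k) \<Rightarrow> ('h, 'h) graph"
  where "perturbation F J = closure (sandwich F J)"

definition T_op :: "('h::complex_inner, 'k::complex_inner) graph \<Rightarrow> ('h, 'h) graph \<Rightarrow> complex \<Rightarrow> 'k \<Rightarrow>\<^sub>L 'k"
  where "T_op F H z = (THE T. compact_operator T \<and> F \<circ>\<^sub>o resolvent H z \<circ>\<^sub>o adj F \<subseteq> graph_of T)"

definition T_limit :: "('h::complex_inner, 'k::complex_inner) graph \<Rightarrow> ('h, 'h) graph \<Rightarrow> real \<Rightarrow> 'k \<Rightarrow>\<^sub>L 'k"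
  where "T_limit F H l = Lim (at_right 0) (\<lambda>y. T_op F H (Complex l y))"

definition regular_points :: "('h::complex_inner, 'k::complex_inner) graph \<Rightarrow> ('h, 'h) graph \<Rightarrow> real set"
  where "regular_points F H = {l. \<exists>L. ((\<lambda>y. T_op F H (Complex l y)) \<longlongrightarrow> L) (at_right 0)}"

definition essentially_regular :: "('h::complex_inner, 'k::complex_inner) graph \<Rightarrow> ('h, 'h) graph set \<Rightarrow> real \<Rightarrow> bool"
  where "essentially_regular F \<A> l \<longleftrightarrow> l \<in> (\<Union>H\<in>\<A>. regular_points F H)"

definition H_line :: "('h::complex_inner, 'h) graph \<Rightarrow> ('h, 'h) graph \<Rightarrow> real \<Rightarrow> ('h, 'h) graph"
  where "H_line H\<^sub>0 V r = H\<^sub>0 +\<^sub>o complex_of_real r *\<^sub>o V"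

definition regular_point_of_triple ::
    "('h::complex_inner, 'k::complex_inner) graph \<Rightarrow> real \<Rightarrow> ('h, 'h) graph \<Rightarrow> ('h, 'h) graph \<Rightarrow> real \<Rightarrow> bool"
  where "regular_point_of_triple F l H\<^sub>0 V r \<longleftrightarrow> l \<in> regular_points F (H_line H\<^sub>0 V r)"

definition resonance_point_of_triple ::
    "('h::complex_inner, 'k::complex_inner) graph \<Rightarrow> real \<Rightarrow> ('h, 'h) graph \<Rightarrow> ('h, 'h) graph \<Rightarrow> real \<Rightarrow> bool"
  where "resonance_point_of_triple F l H\<^sub>0 V r \<longleftrightarrow> l \<notin> regular_points F (H_line H\<^sub>0 V r)"

text \<open>\<open>\<J>\<close> is the real subspace over which \<open>J\<close> runs, \<open>\<A>\<^sub>0(F)\<close> is \<open>perturbation F ` \<J>\<close>, with the real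
  vector space structure inherited from \<open>\<J>\<close>, and \<open>\<D>\<close> is the common domain of the operators in
  \<open>\<A>\<close>. The inclusion of \<open>\<D>\<close> in \<open>dom V\<close> is imposed on the product \<open>F\<^sup>*JF\<close> itself, so that
  \<open>V = F\<^sup>*JF\<close> holds on \<open>\<D>\<close> without closure. The co-kernel of \<open>F\<close> is the orthogonal complement
  of its range, that is, the kernel of its adjoint.\<close>

locale rigged_affine_space =
  fixes F :: "('h::chilbert_space, 'k::chilbert_space) graph"
    and \<J> :: "('k \<Rightarrow>\<^sub>L 'k) set"
    and \<A> :: "('h, 'h) graph set"
    and \<D> :: "'h set"
  assumes separable: "separable_space (euclidean :: 'h topology)"
      "separable_space (euclidean :: 'k topology)"
    and rigging: "linear_operator F" "closed F" "densely_defined F"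
      "kernel F = {0}" "kernel (adj F) = {0}"
    and J_subspace: "subspace \<J>"
    and J_self_adjoint: "J \<in> \<J> \<Longrightarrow> bounded_self_adjoint J"
    and perturbation_self_adjoint: "J \<in> \<J> \<Longrightarrow> self_adjoint (perturbation F J)"
    and affine: "\<exists>H. \<A> = (\<lambda>V. H +\<^sub>o V) ` perturbation F ` \<J>"
    and A_self_adjoint: "H \<in> \<A> \<Longrightarrow> self_adjoint H"
    and A_domain: "H \<in> \<A> \<Longrightarrow> Domain H = \<D>"
    and D_dense: "closure \<D> = UNIV"
    and D_subset_F: "\<D> \<subseteq> Domain F"
    and D_subset_V: "J \<in> \<J> \<Longrightarrow> \<D> \<subseteq> Domain (sandwich F J)"
    and V_relatively_compact: "J \<in> \<J> \<Longrightarrow> H \<in> \<A> \<Longrightarrow> relatively_compact (perturbation F J) H"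
    and T_compact: "H \<in> \<A> \<Longrightarrow> Im z \<noteq> 0 \<Longrightarrow>
      \<exists>T. compact_operator T \<and> F \<circ>\<^sub>o resolvent H z \<circ>\<^sub>o adj F \<subseteq> graph_of T"
    and limiting_absorption: "H \<in> \<A> \<Longrightarrow> - regular_points F H \<in> null_sets lebesgue"

end

theory Submission
  imports Defs
begin

text \<open>Put \<open>z = \<lambda> + iy\<close> and \<open>H = H\<^sub>r\<close>. The eigenvalue equation gives
  \<open>(H - z)\<chi> = (r - r\<^sub>\<lambda>) F\<^sup>*Ju - iy\<chi>\<close>, hence
  \<open>u + (r\<^sub>\<lambda> - r) T\<^sub>z(H)Ju = -iy F R\<^sub>z(H)\<chi>\<close>. Against a vector \<open>g\<close> in the dense subspace \<open>dom F\<^sup>*\<close>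
  the right-hand side is, up to a unimodular factor, \<open>y \<langle>\<chi>, w\<rangle>\<close> with \<open>w = R\<^bsub>cnj z\<^esub>(H)F\<^sup>*g\<close>, and
  \<open>y \<parallel>w\<parallel>\<^sup>2 = \<bar>Im \<langle>T\<^sub>z(H)g, g\<rangle>\<bar>\<close> remains bounded as \<open>y\<close> tends to \<open>0\<close>, because \<open>T\<^sub>z(H)\<close> converges.
  Hence the right-hand side is \<open>O(sqrt y)\<close>.\<close>

section \<open>Complex inner products\<close>

lemma scaleC_zero_left [simp]: "0 *\<^sub>C x = (0::'a::complex_inner)"
  using scaleR_scaleC[of 0 x] by simp

lemma scaleC_one [simp]: "1 *\<^sub>C x = (x::'a::complex_inner)"
  using scaleR_scaleC[of 1 x] by simp

lemma scaleC_minus_left: "(- c) *\<^sub>C x = - (c *\<^sub>C (x::'a::complex_inner))"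
  using scaleC_add_left[of "- c" c x] by (simp add: add_eq_0_iff2)

lemma scaleC_minus1: "(- 1) *\<^sub>C x = - (x::'a::complex_inner)"
  by (simp add: scaleC_minus_left)

lemma cinner_add_left: "cinner (x + y) z = cinner x z + cinner y (z::'a::complex_inner)"
  by (metis cinner_add_right cinner_commute complex_cnj_add)

lemma cinner_scaleC_left: "cinner (c *\<^sub>C x) y = cnj c * cinner x (y::'a::complex_inner)"
  by (metis cinner_scaleC_right cinner_commute complex_cnj_mult)

lemma cinner_minus_right: "cinner x (- y) = - cinner x (y::'a::complex_inner)"
  using cinner_scaleC_right[of x "- 1" y] by (simp add: scaleC_minus1)

lemma cinner_minus_left: "cinner (- x) y = - cinner x (y::'a::complex_inner)"
  by (metis cinner_minus_right cinner_commute complex_cnj_minus)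

lemma cinner_diff_right: "cinner x (y - z) = cinner x y - cinner x (z::'a::complex_inner)"
  using cinner_add_right[of x y "- z"] by (simp add: cinner_minus_right)

lemma cinner_diff_left: "cinner (x - y) z = cinner x z - cinner y (z::'a::complex_inner)"
  using cinner_add_left[of x "- y" z] by (simp add: cinner_minus_left)

lemma cinner_zero_right [simp]: "cinner x 0 = (0::complex)" for x :: "'a::complex_inner"
  using cinner_diff_right[of x 0 0] by simp

lemma cinner_zero_left [simp]: "cinner 0 x = (0::complex)" for x :: "'a::complex_inner"
  using cinner_diff_left[of 0 0 x] by simp

text \<open>A norm is nonnegative and \<open>sqrt\<close> is negative on negative reals, so the real
  part under the root is nonnegative; conjugate symmetry removes the imaginary part.\<close>

lemma cinner_self: "cinner x x = complex_of_real ((norm x)\<^sup>2)" for x :: "'a::complex_inner"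
proof -
  have "sqrt (Re (cinner x x)) \<ge> 0"
    by (metis norm_eq_sqrt_cinner norm_ge_zero)
  then have "Re (cinner x x) = (norm x)\<^sup>2"
    by (simp add: norm_eq_sqrt_cinner)
  moreover have "Im (cinner x x) = 0"
    using arg_cong[OF cinner_commute[of x x], of Im] by simp
  ultimately show ?thesis
    by (simp add: complex_eq_iff)
qed

text \<open>Pythagoras for the projection of \<open>x\<close> onto the line through
  \<open>y\<close>. Nonnegativity of the left side gives Cauchy-Schwarz; the exact value shows how
  far a step along \<open>y\<close> shortens \<open>x\<close>.\<close>

lemma norm_diff_projection:
  fixes x y :: "'a::complex_inner"
  assumes "y \<noteq> 0"
  shows "(norm (x - (cinner y x / of_real ((norm y)\<^sup>2)) *\<^sub>C y))\<^sup>2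
    = (norm x)\<^sup>2 - (cmod (cinner y x))\<^sup>2 / (norm y)\<^sup>2" (is "(norm (x - ?c *\<^sub>C y))\<^sup>2 = _")
proof -
  have xy: "cinner x y = cnj (cinner y x)"
    by (rule cinner_commute)
  have "complex_of_real ((norm (x - ?c *\<^sub>C y))\<^sup>2)
      = cinner (x - ?c *\<^sub>C y) (x - ?c *\<^sub>C y)"
    by (simp only: cinner_self)
  also have "\<dots> = cinner x x - ?c * cnj (cinner y x) - cnj ?c * cinner y x
      + cnj ?c * ?c * cinner y y"
    by (simp add: cinner_diff_left cinner_diff_right cinner_scaleC_left cinner_scaleC_right xy
        algebra_simps)
  also have "\<dots> = complex_of_real ((norm x)\<^sup>2) - cinner y x * cnj (cinner y x) / of_real ((norm y)\<^sup>2)"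
    using assms by (simp add: cinner_self field_simps power2_eq_square)
  also have "\<dots> = complex_of_real ((norm x)\<^sup>2 - (cmod (cinner y x))\<^sup>2 / (norm y)\<^sup>2)"
    by (simp flip: complex_norm_square)
  finally show ?thesis
    using of_real_eq_iff by blast
qed

lemma cinner_Cauchy_Schwarz: "cmod (cinner x y) \<le> norm x * norm y" for x y :: "'a::complex_inner"
proof (cases "x = 0")
  case False
  then have "(cmod (cinner x y))\<^sup>2 / (norm x)\<^sup>2 \<le> (norm y)\<^sup>2"
    using norm_diff_projection[OF False, of y]
      zero_le_power2[of "norm (y - (cinner x y / of_real ((norm x)\<^sup>2)) *\<^sub>C x)"]
    by linarith
  then have "(cmod (cinner x y))\<^sup>2 \<le> (norm x * norm y)\<^sup>2"
    using False by (simp add: field_simps)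
  then show ?thesis
    by (rule power2_le_imp_le) simp
qed simp

lemma parallelogram_law:
  "(norm (x + y))\<^sup>2 + (norm (x - y))\<^sup>2 = 2 * (norm x)\<^sup>2 + 2 * (norm y)\<^sup>2"
  for x y :: "'a::complex_inner"
proof -
  have "complex_of_real ((norm (x + y))\<^sup>2 + (norm (x - y))\<^sup>2)
      = cinner (x + y) (x + y) + cinner (x - y) (x - y)"
    by (simp only: cinner_self of_real_add)
  also have "\<dots> = 2 * cinner x x + 2 * cinner y y"
    by (simp add: cinner_add_left cinner_add_right cinner_diff_left cinner_diff_right)
  also have "\<dots> = complex_of_real (2 * (norm x)\<^sup>2 + 2 * (norm y)\<^sup>2)"
    by (simp add: cinner_self)
  finally show ?thesis
    using of_real_eq_iff by blast
qed

lemma tendsto_cinner_left: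
  fixes f :: "'b \<Rightarrow> 'a::complex_inner"
  assumes "(f \<longlongrightarrow> a) G"
  shows "((\<lambda>t. cinner x (f t)) \<longlongrightarrow> cinner x a) G"
proof -
  have "((\<lambda>t. cinner x (f t) - cinner x a) \<longlongrightarrow> 0) G"
  proof (rule Lim_null_comparison)
    show "\<forall>\<^sub>F t in G. norm (cinner x (f t) - cinner x a) \<le> norm x * norm (f t - a)"
      by (simp add: cinner_Cauchy_Schwarz flip: cinner_diff_right)
    show "((\<lambda>t. norm x * norm (f t - a)) \<longlongrightarrow> 0) G"
      by (intro tendsto_mult_right_zero tendsto_norm_zero LIM_zero assms)
  qed
  then show ?thesis
    by (rule LIM_zero_cancel)
qed

text \<open>A closed operator is a closed subspace of the product space, so this structure allows
  orthogonal projection onto a graph. The existing norm on pairs is already the Euclidean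
  one.\<close>

instantiation prod :: (complex_inner, complex_inner) complex_inner
begin

definition scaleC_prod :: "complex \<Rightarrow> 'a \<times> 'b \<Rightarrow> 'a \<times> 'b"
  where "scaleC_prod c p = (c *\<^sub>C fst p, c *\<^sub>C snd p)"

definition cinner_prod :: "'a \<times> 'b \<Rightarrow> 'a \<times> 'b \<Rightarrow> complex"
  where "cinner_prod p q = cinner (fst p) (fst q) + cinner (snd p) (snd q)"

instance
proof
  show "cinner x y = cnj (cinner y x)" for x y :: "'a \<times> 'b"
    unfolding cinner_prod_def by (metis cinner_commute complex_cnj_add)
  show "norm x = sqrt (Re (cinner x x))" for x :: "'a \<times> 'b"
    by (simp add: cinner_prod_def norm_prod_def cinner_self)
qed (simp_all add: scaleC_prod_def cinner_prod_def scaleC_add_right scaleC_add_left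
    scaleC_scaleC cinner_add_right cinner_scaleC_right algebra_simps prod_eq_iff
    flip: scaleR_scaleC)

end

instance prod :: (chilbert_space, chilbert_space) chilbert_space ..

section \<open>Orthogonal projection\<close>

text \<open>A minimizing sequence is Cauchy: midpoints of its members stay in the convex set, and
  the parallelogram law turns their distance from \<open>x\<close> into a bound on the gaps.\<close>

lemma nearest_point_exists:
  fixes S :: "'a::chilbert_space set"
  assumes "closed S" "convex S" "S \<noteq> {}"
  obtains p where "p \<in> S" "\<And>s. s \<in> S \<Longrightarrow> norm (x - p) \<le> norm (x - s)"
proof -
  define d where "d = infdist x S"
  have d_le: "d \<le> norm (x - s)" if "s \<in> S" for s
    using infdist_le[OF that, of x] by (simp add: d_def dist_norm)
  have d0: "0 \<le> d"
    by (simp add: d_def infdist_nonneg)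
  \<comment> \<open>The slack is put on the squared distance because the parallelogram law is about
    squares.\<close>
  have "\<exists>s\<in>S. (norm (x - s))\<^sup>2 < d\<^sup>2 + 1 / Suc n" for n
  proof -
    have "d < sqrt (d\<^sup>2 + 1 / Suc n)"
      using d0 by (intro real_less_rsqrt) simp
    then obtain s where s: "s \<in> S" "dist x s < sqrt (d\<^sup>2 + 1 / Suc n)"
      using \<open>S \<noteq> {}\<close> unfolding d_def infdist_def by (auto simp: cINF_less_iff)
    then have "(norm (x - s))\<^sup>2 < (sqrt (d\<^sup>2 + 1 / Suc n))\<^sup>2"
      by (intro power_strict_mono) (auto simp: dist_norm)
    with s(1) show ?thesis
      by auto
  qed
  then obtain s where s: "\<And>n. s n \<in> S" "\<And>n. (norm (x - s n))\<^sup>2 < d\<^sup>2 + 1 / Suc n"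
    by metis
  have gap: "(norm (s m - s n))\<^sup>2 < 2 / Suc m + 2 / Suc n" for m n
  proof -
    \<comment> \<open>The midpoint is no closer to \<open>x\<close> than \<open>d\<close>, so in the
      parallelogram law the terms in \<open>d\<close> cancel and only the two slacks, doubled,
      remain.\<close>
    define q where "q = (1/2) *\<^sub>R s m + (1/2) *\<^sub>R s n"
    have "q \<in> S"
      unfolding q_def using assms(2) s(1) by (intro convexD) auto
    then have "d\<^sup>2 \<le> (norm (x - q))\<^sup>2"
      using d0 d_le by (simp add: power_mono)
    moreover have "(x - s n) + (x - s m) = 2 *\<^sub>R (x - q)"
      by (simp add: q_def algebra_simps scaleR_2)
    then have "(norm ((x - s n) + (x - s m)))\<^sup>2 = 4 * (norm (x - q))\<^sup>2"
      by (simp add: power_mult_distrib)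
    moreover have "(x - s n) - (x - s m) = s m - s n"
      by simp
    ultimately show ?thesis
      using parallelogram_law[of "x - s n" "x - s m"] s(2)[of n] s(2)[of m] by simp
  qed
  have "Cauchy s"
  proof (rule CauchyI)
    fix e :: real
    assume "0 < e"
    obtain N :: nat where N: "4 / e\<^sup>2 < N"
      using reals_Archimedean2 by blast
    have "norm (s m - s n) < e" if "m \<ge> N" "n \<ge> N" for m n
    proof -
      have "2 / Suc k < e\<^sup>2 / 2" if "k \<ge> N" for k
      proof -
        have "4 / e\<^sup>2 < Suc k"
          using N that by linarith
        then show ?thesis
          using \<open>0 < e\<close> by (simp add: field_simps)
      qed
      from this[OF that(1)] this[OF that(2)] have "(norm (s m - s n))\<^sup>2 < e\<^sup>2"
        using gap[of m n] by linarith
      then show ?thesis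
        using \<open>0 < e\<close> by (meson less_eq_real_def power_less_imp_less_base)
    qed
    then show "\<exists>N. \<forall>m\<ge>N. \<forall>n\<ge>N. norm (s m - s n) < e"
      by blast
  qed
  then obtain p where p: "s \<longlonglongrightarrow> p"
    using Cauchy_convergent convergent_def by blast
  have "p \<in> S"
    using closed_sequentially[OF assms(1) _ p] s(1) by blast
  moreover have "(norm (x - p))\<^sup>2 \<le> d\<^sup>2"
  proof (rule LIMSEQ_le)
    show "(\<lambda>n. (norm (x - s n))\<^sup>2) \<longlonglongrightarrow> (norm (x - p))\<^sup>2"
      by (intro tendsto_intros p)
    have "(\<lambda>n. d\<^sup>2 + 1 / Suc n) \<longlonglongrightarrow> d\<^sup>2 + 0"
      by (intro tendsto_intros LIMSEQ_Suc lim_1_over_n)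
    then show "(\<lambda>n. d\<^sup>2 + 1 / Suc n) \<longlonglongrightarrow> d\<^sup>2"
      by simp
    show "\<exists>N. \<forall>n\<ge>N. (norm (x - s n))\<^sup>2 \<le> d\<^sup>2 + 1 / Suc n"
      using s(2) less_imp_le by blast
  qed
  then have "norm (x - p) \<le> d"
    using d0 power2_le_imp_le by blast
  ultimately show ?thesis
    using d_le that order_trans by blast
qed

text \<open>Take \<open>p\<close> nearest to \<open>x\<close>. Moving \<open>p\<close> along
  \<open>s\<close> by the projection coefficient would lower the squared distance by
  \<open>(cmod (cinner s (x - p)))\<^sup>2 / (norm s)\<^sup>2\<close>, so this quantity must
  vanish.\<close>

lemma orthogonal_decomposition:
  fixes S :: "'a::chilbert_space set"
  assumes "closed S" and S: "0 \<in> S" "\<And>s t. s \<in> S \<Longrightarrow> t \<in> S \<Longrightarrow> s + t \<in> S"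
    "\<And>c s. s \<in> S \<Longrightarrow> c *\<^sub>C s \<in> S"
  obtains p where "p \<in> S" "\<And>s. s \<in> S \<Longrightarrow> cinner s (x - p) = 0"
proof -
  have "convex S"
    unfolding convex_def by (auto simp: scaleR_scaleC intro: S)
  then obtain p where p: "p \<in> S" "\<And>s. s \<in> S \<Longrightarrow> norm (x - p) \<le> norm (x - s)"
    using nearest_point_exists[OF assms(1)] S(1) by blast
  have "cinner s (x - p) = 0" if "s \<in> S" for s
  proof (cases "s = 0")
    case False
    let ?c = "cinner s (x - p) / of_real ((norm s)\<^sup>2)"
    have "(norm (x - p))\<^sup>2 \<le> (norm (x - (p + ?c *\<^sub>C s)))\<^sup>2"
      using p that S by (intro power_mono) auto
    then have "(cmod (cinner s (x - p)))\<^sup>2 / (norm s)\<^sup>2 \<le> 0"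
      using norm_diff_projection[OF False, of "x - p"] unfolding diff_diff_eq by linarith
    then show ?thesis
      using False by (simp add: divide_le_0_iff)
  qed simp
  with p(1) show ?thesis
    using that by blast
qed

section \<open>Unbounded operators\<close>

lemma linear_operator_diff_scaleC:
  assumes "linear_operator A" "(x, y) \<in> A" "(x', y') \<in> A"
  shows "(x - c *\<^sub>C x', y - c *\<^sub>C y') \<in> A"
proof -
  have "(x + (- c) *\<^sub>C x', y + (- c) *\<^sub>C y') \<in> A"
    using assms unfolding linear_operator_def by blast
  then show ?thesis
    by (simp add: scaleC_minus_left)
qed

lemma linear_operator_unique:
  "linear_operator A \<Longrightarrow> (x, y) \<in> A \<Longrightarrow> (x, y') \<in> A \<Longrightarrow> y = y'"
  unfolding linear_operator_def single_valued_def by blast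

lemma adjD: "(y, z) \<in> adj A \<Longrightarrow> (x, w) \<in> A \<Longrightarrow> cinner w y = cinner x z"
  unfolding adj_def by blast

lemma adj_add: "(y, z) \<in> adj A \<Longrightarrow> (y', z') \<in> adj A \<Longrightarrow> (y + y', z + z') \<in> adj A"
  unfolding adj_def by (auto simp: cinner_add_right dest!: bspec)

lemma adj_scaleC: "(y, z) \<in> adj A \<Longrightarrow> (c *\<^sub>C y, c *\<^sub>C z) \<in> adj A"
  unfolding adj_def by (auto simp: cinner_scaleC_right)

text \<open>Decompose \<open>(0, y)\<close> along the graph of \<open>A\<close>: a vector \<open>(p, q)\<close> orthogonal to the graph is
  the same as \<open>(q, -p)\<close> in the graph of the adjoint.\<close>

lemma orthogonal_Domain_adj_eq_zero:
  fixes A :: "('a::chilbert_space, 'b::chilbert_space) graph"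
  assumes "linear_operator A" "closed A" and orth: "\<And>g. g \<in> Domain (adj A) \<Longrightarrow> cinner g y = 0"
  shows "y = 0"
proof -
  have zero: "(0, 0) \<in> A"
    and add: "(x, v) \<in> A \<Longrightarrow> (x', v') \<in> A \<Longrightarrow> (x + x', v + v') \<in> A"
    and scale: "(x, v) \<in> A \<Longrightarrow> (c *\<^sub>C x, c *\<^sub>C v) \<in> A" for x v x' v' c
    using assms(1) unfolding linear_operator_def by blast+
  obtain a where a: "a \<in> A" "\<And>s. s \<in> A \<Longrightarrow> cinner s ((0, y) - a) = 0"
  proof (rule orthogonal_decomposition[OF assms(2), of "(0, y)"])
    show "0 \<in> A"
      using zero by (simp add: zero_prod_def)
    show "s + t \<in> A" if "s \<in> A" "t \<in> A" for s t
      using add[of "fst s" "snd s" "fst t" "snd t"] that by (simp add: plus_prod_def)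
    show "c *\<^sub>C s \<in> A" if "s \<in> A" for c s
      using scale[of "fst s" "snd s" c] that by (simp add: scaleC_prod_def)
  qed blast
  define e where "e = (0, y) - a"
  have "(snd e, - fst e) \<in> adj A"
    using a(2) unfolding adj_def e_def[symmetric]
    by (auto simp: cinner_prod_def cinner_minus_right add_eq_0_iff2 dest!: a(2)[folded e_def])
  then have "cinner (snd e) y = 0"
    using orth by blast
  \<comment> \<open>Now \<open>e\<close> is orthogonal to both \<open>(0, y)\<close> and
    \<open>a\<close>, hence to their difference \<open>e\<close> itself. So \<open>(0, y)\<close>
    lies in the graph, whose value at 0 is 0.\<close>
  then have "cinner (0, y) e = 0"
    by (simp add: cinner_prod_def cinner_commute[of y])
  moreover have "cinner a e = 0"
    using a e_def by blast
  ultimately have "cinner e e = 0"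
    by (simp add: e_def cinner_diff_left)
  then have "e = 0"
    by (simp add: cinner_self)
  then have "(0, y) \<in> A"
    using a(1) by (simp add: e_def)
  then show ?thesis
    using zero linear_operator_unique assms(1) by blast
qed

text \<open>Density of the domain of the adjoint, in the form used to extend identities from it: the
  component of a vector orthogonal to \<open>S\<close> is orthogonal to that domain, hence
  zero.\<close>

lemma closed_superspace_Domain_adj:
  fixes A :: "('a::chilbert_space, 'b::chilbert_space) graph"
  assumes "linear_operator A" "closed A" and "Domain (adj A) \<subseteq> S"
    and S: "closed S" "0 \<in> S" "\<And>s t. s \<in> S \<Longrightarrow> t \<in> S \<Longrightarrow> s + t \<in> S"
    "\<And>c s. s \<in> S \<Longrightarrow> c *\<^sub>C s \<in> S"
  shows "S = UNIV"
proof -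
  have "y \<in> S" for y
  proof -
    obtain p where p: "p \<in> S" "\<And>s. s \<in> S \<Longrightarrow> cinner s (y - p) = 0"
      using orthogonal_decomposition[OF S] by metis
    then have "y - p = 0"
      using orthogonal_Domain_adj_eq_zero[OF assms(1,2)] assms(3) by blast
    then show ?thesis
      using p(1) by simp
  qed
  then show ?thesis
    by blast
qed

lemma resolvent_iff: "(v, a) \<in> resolvent H z \<longleftrightarrow> (a, v + z *\<^sub>C a) \<in> H"
proof -
  have "(v, a) \<in> resolvent H z \<longleftrightarrow> (\<exists>b. (a, b) \<in> H \<and> v = b + (- z) *\<^sub>C a)"
    unfolding resolvent_def op_plus_def op_scale_def by auto
  also have "\<dots> \<longleftrightarrow> (a, v + z *\<^sub>C a) \<in> H"
    by (auto simp: scaleC_minus_left)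
  finally show ?thesis .
qed

lemma self_adjoint_symmetric:
  "self_adjoint H \<Longrightarrow> (x, a) \<in> H \<Longrightarrow> (y, b) \<in> H \<Longrightarrow> cinner a y = cinner x b"
  unfolding self_adjoint_def using adjD by metis

text \<open>The composite with \<open>V\<close> is the graph of an everywhere defined operator, so
  its first factor is everywhere defined. This supplies the surjectivity of H - z.\<close>

lemma relatively_compact_Domain_resolvent:
  assumes "relatively_compact V H" "Im z \<noteq> 0"
  shows "Domain (resolvent H z) = UNIV"
proof -
  obtain C where "V \<circ>\<^sub>o resolvent H z = graph_of C"
    using assms unfolding relatively_compact_def by blast
  then show ?thesis
    unfolding graph_of_def by blast
qed

section \<open>The sandwiched resolvent\<close>

context rigged_affine_space
begin

section \<open>Perturbations on the common domain and lines in the affine space\<close>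

lemma perturbation_unique:
  "J \<in> \<J> \<Longrightarrow> (x, v) \<in> perturbation F J \<Longrightarrow> (x, v') \<in> perturbation F J \<Longrightarrow> v = v'"
  using perturbation_self_adjoint linear_operator_unique unfolding self_adjoint_def by blast

text \<open>On \<open>\<D>\<close> the product already has a value. That value also belongs to the
  closure, which is single-valued because it is self-adjoint.\<close>

lemma perturbation_imp_sandwich:
  assumes "J \<in> \<J>" "x \<in> \<D>" "(x, v) \<in> perturbation F J"
  shows "(x, v) \<in> sandwich F J"
proof -
  obtain v' where v': "(x, v') \<in> sandwich F J"
    using D_subset_V assms by blast
  then have "(x, v') \<in> perturbation F J"
    unfolding perturbation_def using closure_subset by blast
  then show ?thesis
    using perturbation_unique assms v' by blast
qed

lemma sandwich_iff: "(x, v) \<in> sandwich F J \<longleftrightarrow> (\<exists>w. (x, w) \<in> F \<and> (J w, v) \<in> adj F)"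
  unfolding sandwich_def graph_of_def by auto

lemma sandwich_add_scaleR:
  assumes "(x, v) \<in> sandwich F J" "(x, v') \<in> sandwich F J'"
  shows "(x, v + complex_of_real r *\<^sub>C v') \<in> sandwich F (J + r *\<^sub>R J')"
proof -
  obtain w w' where w: "(x, w) \<in> F" "(J w, v) \<in> adj F" "(x, w') \<in> F" "(J' w', v') \<in> adj F"
    using assms unfolding sandwich_iff by blast
  moreover have "w' = w"
    using w linear_operator_unique rigging(1) by blast
  ultimately show ?thesis
    unfolding sandwich_iff by (auto simp: blinfun.add_left blinfun.scaleR_left scaleR_scaleC
        intro!: exI[of _ w] adj_add adj_scaleC)
qed

text \<open>The natural parameter is \<open>J\<^sub>0 + r *\<^sub>R J\<close>. Closures need not
  respect sums, so the two operators are compared on \<open>\<D>\<close>, where every perturbation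
  is the plain product.\<close>

lemma H_line_in_affine_space:
  assumes "H\<^sub>0 \<in> \<A>" "J \<in> \<J>"
  shows "H_line H\<^sub>0 (perturbation F J) r \<in> \<A>"
proof -
  obtain H where H: "\<A> = (\<lambda>V. H +\<^sub>o V) ` perturbation F ` \<J>"
    using affine by blast
  then obtain J\<^sub>0 where J0: "J\<^sub>0 \<in> \<J>" "H\<^sub>0 = H +\<^sub>o perturbation F J\<^sub>0"
    using assms by blast
  define J' where "J' = J\<^sub>0 + r *\<^sub>R J"
  have J': "J' \<in> \<J>"
    unfolding J'_def using J_subspace J0 assms subspace_add subspace_scale by blast
  define H' where "H' = H +\<^sub>o perturbation F J'"
  have H': "H' \<in> \<A>"
    using H J' H'_def by blast
  have sub: "sandwich F K \<subseteq> perturbation F K" for K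
    unfolding perturbation_def by (rule closure_subset)
  have "(x, y) \<in> H_line H\<^sub>0 (perturbation F J) r \<longleftrightarrow> (x, y) \<in> H'" for x y
  proof
    assume "(x, y) \<in> H_line H\<^sub>0 (perturbation F J) r"
    then obtain h v where hv: "(x, h) \<in> H\<^sub>0" "(x, v) \<in> perturbation F J"
      "y = h + complex_of_real r *\<^sub>C v"
      unfolding H_line_def op_plus_def op_scale_def by blast
    then have x: "x \<in> \<D>"
      using A_domain assms by blast
    obtain a v\<^sub>0 where a: "(x, a) \<in> H" "(x, v\<^sub>0) \<in> perturbation F J\<^sub>0" "h = a + v\<^sub>0"
      using hv(1) J0(2) unfolding op_plus_def by blast
    have "(x, v\<^sub>0 + complex_of_real r *\<^sub>C v) \<in> perturbation F J'"
      unfolding J'_def using sub x a hv J0 assms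
      by (meson sandwich_add_scaleR perturbation_imp_sandwich subsetD)
    then show "(x, y) \<in> H'"
      unfolding H'_def op_plus_def using a hv by (auto simp: add.assoc)
  next
    assume "(x, y) \<in> H'"
    then obtain a v' where a: "(x, a) \<in> H" "(x, v') \<in> perturbation F J'" "y = a + v'"
      unfolding H'_def op_plus_def by blast
    have x: "x \<in> \<D>"
      using A_domain H' \<open>(x, y) \<in> H'\<close> by blast
    \<comment> \<open>The decomposition is built from the products and then identified with
      \<open>v'\<close> by single-valuedness of the perturbation.\<close>
    obtain v\<^sub>0 v where v: "(x, v\<^sub>0) \<in> sandwich F J\<^sub>0" "(x, v) \<in> sandwich F J"
      using x D_subset_V J0 assms by blast
    then have "(x, v\<^sub>0 + complex_of_real r *\<^sub>C v) \<in> perturbation F J'"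
      unfolding J'_def using sub sandwich_add_scaleR by blast
    then have "v' = v\<^sub>0 + complex_of_real r *\<^sub>C v"
      using a J' perturbation_unique by blast
    then have "y = (a + v\<^sub>0) + complex_of_real r *\<^sub>C v"
      using a by (simp add: add.assoc)
    moreover have "(x, a + v\<^sub>0) \<in> H\<^sub>0"
      unfolding J0(2) op_plus_def using a v sub by blast
    ultimately show "(x, y) \<in> H_line H\<^sub>0 (perturbation F J) r"
      unfolding H_line_def op_plus_def op_scale_def using v sub by blast
  qed
  then have "H_line H\<^sub>0 (perturbation F J) r = H'"
    by auto
  then show ?thesis
    using H' by simp
qed

section \<open>The sandwiched resolvent off the real axis\<close>

lemma resolvent_exists:
  assumes "H \<in> \<A>" "Im z \<noteq> 0"
  obtains a b where "(v, a) \<in> resolvent H z" "(a, b) \<in> F"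
proof -
  \<comment> \<open>Some member of \<open>\<J>\<close> is required to invoke relative compactness;
    zero is always available.\<close>
  have "0 \<in> \<J>"
    using J_subspace subspace_0 by blast
  then obtain a where a: "(v, a) \<in> resolvent H z"
    using relatively_compact_Domain_resolvent V_relatively_compact assms by blast
  then have "a \<in> \<D>"
    using A_domain assms(1) unfolding resolvent_iff by blast
  then show ?thesis
    using a that D_subset_F by blast
qed

text \<open>Existence is assumed, so the description in \<open>T_op\<close> needs uniqueness: two
  bounded extensions agree on a closed subspace containing the dense domain of
  \<open>adj F\<close>.\<close>

lemma T_op_extends:
  assumes "H \<in> \<A>" "Im z \<noteq> 0"
  shows "F \<circ>\<^sub>o resolvent H z \<circ>\<^sub>o adj F \<subseteq> graph_of (T_op F H z)"
proof -
  let ?P = "\<lambda>T. compact_operator T \<and> F \<circ>\<^sub>o resolvent H z \<circ>\<^sub>o adj F \<subseteq> graph_of T"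
  obtain T where T: "?P T"
    using T_compact assms by blast
  have "T' = T" if T': "?P T'" for T'
  proof (rule blinfun_eqI)
    fix g
    let ?E = "{g. T' g = T g}"
    have "Domain (adj F) \<subseteq> ?E"
    proof
      fix g
      assume "g \<in> Domain (adj F)"
      then obtain v where v: "(g, v) \<in> adj F"
        by blast
      obtain a b where "(v, a) \<in> resolvent H z" "(a, b) \<in> F"
        using resolvent_exists assms .
      with v have "(g, b) \<in> F \<circ>\<^sub>o resolvent H z \<circ>\<^sub>o adj F"
        by blast
      then show "g \<in> ?E"
        using T T' unfolding graph_of_def by blast
    qed
    moreover have "closed ?E"
      by (intro closed_Collect_eq continuous_intros)
    ultimately have "?E = UNIV"
      using T T' unfolding compact_operator_def complex_linear_def
      by (intro closed_superspace_Domain_adj[OF rigging(1,2)]) (auto simp: blinfun.add_right)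
    then show "T' g = T g"
      by blast
  qed
  with T have "?P (T_op F H z)"
    unfolding T_op_def by (rule theI)
  then show ?thesis
    by blast
qed

lemma T_op_eq:
  assumes "H \<in> \<A>" "Im z \<noteq> 0" "(g, v) \<in> adj F" "(v, a) \<in> resolvent H z" "(a, b) \<in> F"
  shows "b = T_op F H z g"
proof -
  have "(g, b) \<in> F \<circ>\<^sub>o resolvent H z \<circ>\<^sub>o adj F"
    using assms(3-) by (intro relcompI)
  then have "(g, b) \<in> graph_of (T_op F H z)"
    by (rule subsetD[OF T_op_extends[OF assms(1,2)]])
  then show ?thesis
    by (simp add: graph_of_def)
qed

text \<open>With \<open>b\<close> the value of \<open>T_op F H z\<close> at \<open>g\<close>,
  symmetry of \<open>H\<close> gives the identity
  \<open>Im z * (norm w)\<^sup>2 = - Im (cinner b g)\<close>; Cauchy-Schwarz does the rest.\<close>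

lemma resolvent_adj_bound:
  assumes "H \<in> \<A>" "Im z > 0" "(g, v) \<in> adj F" "(v, w) \<in> resolvent H (cnj z)"
  shows "Im z * (norm w)\<^sup>2 \<le> norm (T_op F H z) * (norm g)\<^sup>2"
proof -
  have sa: "self_adjoint H"
    using A_self_adjoint assms(1) .
  obtain a b where a: "(v, a) \<in> resolvent H z" "(a, b) \<in> F"
    using resolvent_exists[of H z v] assms by auto
  have b: "b = T_op F H z g"
    using T_op_eq assms a by simp
  have aH: "(a, v + z *\<^sub>C a) \<in> H" and wH: "(w, v + cnj z *\<^sub>C w) \<in> H"
    using a assms(4) by (simp_all add: resolvent_iff)
  \<comment> \<open>Symmetry applied to \<open>a\<close> and \<open>w\<close> produces the term
    \<open>cnj z * cinner a w\<close> on both sides, where it cancels.\<close>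
  have "cinner v w = cinner a v"
    using self_adjoint_symmetric[OF sa aH wH]
    by (simp add: cinner_add_left cinner_add_right cinner_scaleC_left cinner_scaleC_right)
  also have "\<dots> = cinner b g"
    using adjD[OF assms(3) a(2)] by simp
  finally have vw: "cinner v w = cinner b g" .
  \<comment> \<open>Pairing \<open>w\<close> with itself: the imaginary part isolates the squared
    norm of \<open>w\<close>.\<close>
  have *: "cinner v w + z * cinner w w = cinner w v + cnj z * cinner w w"
    using self_adjoint_symmetric[OF sa wH wH]
    by (simp add: cinner_add_left cinner_add_right cinner_scaleC_left cinner_scaleC_right)
  have "Im (cinner v w) + Im z * (norm w)\<^sup>2 = Im (cinner w v) - Im z * (norm w)\<^sup>2"
    using arg_cong[OF *, of Im] by (simp add: cinner_self)
  moreover have "Im (cinner w v) = - Im (cinner v w)"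
    using arg_cong[OF cinner_commute[of w v], of Im] by simp
  ultimately have "Im z * (norm w)\<^sup>2 = - Im (cinner b g)"
    by (simp add: vw)
  also have "\<dots> \<le> cmod (cinner b g)"
    using abs_Im_le_cmod[of "cinner b g"] by linarith
  also have "\<dots> \<le> norm b * norm g"
    by (rule cinner_Cauchy_Schwarz)
  also have "\<dots> \<le> norm (T_op F H z) * norm g * norm g"
    unfolding b by (intro mult_right_mono norm_blinfun norm_ge_zero)
  finally show ?thesis
    by (simp add: power2_eq_square mult.assoc)
qed

text \<open>Symmetry moves the resolvent from \<open>x\<close> to \<open>adj F\<close> applied to
  \<open>g\<close>, leaving the inner product of \<open>x\<close> with \<open>w\<close>. The
  previous bound controls \<open>y * (norm w)\<^sup>2\<close>, so \<open>y * norm w\<close> gains a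
  factor \<open>sqrt y\<close>.\<close>

lemma weak_resolvent_bound:
  assumes "H \<in> \<A>" "y > 0" "g \<in> Domain (adj F)"
    and "(x, c) \<in> resolvent H (Complex l y)" "(c, d) \<in> F"
  shows "y * cmod (cinner g d) \<le> norm x * sqrt (y * norm (T_op F H (Complex l y))) * norm g"
proof -
  let ?z = "Complex l y"
  let ?N = "norm (T_op F H ?z)"
  obtain v where v: "(g, v) \<in> adj F"
    using assms(3) by blast
  obtain w where w: "(v, w) \<in> resolvent H (cnj ?z)"
    using resolvent_exists[of H "cnj ?z" v] assms by auto
  have cH: "(c, x + ?z *\<^sub>C c) \<in> H" and wH: "(w, v + cnj ?z *\<^sub>C w) \<in> H"
    using assms(4) w by (simp_all add: resolvent_iff)
  have "cinner x w = cinner c v"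
    using self_adjoint_symmetric[OF A_self_adjoint[OF assms(1)] cH wH]
    by (simp add: cinner_add_left cinner_add_right cinner_scaleC_left cinner_scaleC_right)
  also have "\<dots> = cinner d g"
    using adjD[OF v assms(5)] by simp
  finally have "cinner g d = cnj (cinner x w)"
    by (simp add: cinner_commute[of g d])
  then have "cmod (cinner g d) \<le> norm x * norm w"
    by (simp add: cinner_Cauchy_Schwarz)
  then have "y * cmod (cinner g d) \<le> norm x * (y * norm w)"
    using assms(2) by (simp add: mult.left_commute)
  moreover have "(y * norm w)\<^sup>2 \<le> (sqrt (y * ?N) * norm g)\<^sup>2"
  proof -
    have "y * (y * (norm w)\<^sup>2) \<le> y * (?N * (norm g)\<^sup>2)"
      using resolvent_adj_bound[OF assms(1) _ v w] assms(2) by (intro mult_left_mono) auto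
    then show ?thesis
      using assms(2) by (simp add: power_mult_distrib power2_eq_square mult_ac)
  qed
  then have "y * norm w \<le> sqrt (y * ?N) * norm g"
    by (rule power2_le_imp_le) (use assms(2) in auto)
  ultimately show ?thesis
    using mult_left_mono[of "y * norm w" "sqrt (y * ?N) * norm g" "norm x"]
    by (simp add: mult.assoc)
qed

text \<open>Solves the shifted eigenvalue equation at coupling \<open>r\<close> and applies
  \<open>F\<close>. The witnesses \<open>c\<close> and \<open>d\<close> are exposed so that the
  remainder can be fed to \<open>weak_resolvent_bound\<close>.\<close>

lemma eigenvector_resolvent_identity:
  assumes "H\<^sub>0 \<in> \<A>" "J \<in> \<J>" "y > 0" "(\<psi>, u) \<in> F"
    and eig: "(\<psi>, complex_of_real l *\<^sub>C \<psi>) \<in> H_line H\<^sub>0 (perturbation F J) s"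
  obtains c d where
    "(\<psi>, c) \<in> resolvent (H_line H\<^sub>0 (perturbation F J) r) (Complex l y)" "(c, d) \<in> F"
    "u + (s - r) *\<^sub>R T_op F (H_line H\<^sub>0 (perturbation F J) r) (Complex l y) (J u)
      = - ((\<i> * of_real y) *\<^sub>C d)"
proof -
  let ?z = "Complex l y"
  let ?H = "H_line H\<^sub>0 (perturbation F J) r"
  have HA: "?H \<in> \<A>"
    using H_line_in_affine_space assms by blast
  then have lin: "linear_operator ?H"
    using A_self_adjoint unfolding self_adjoint_def by blast
  obtain h v where hv: "(\<psi>, h) \<in> H\<^sub>0" "(\<psi>, v) \<in> perturbation F J"
    "complex_of_real l *\<^sub>C \<psi> = h + complex_of_real s *\<^sub>C v"
    using eig unfolding H_line_def op_plus_def op_scale_def by blast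
  then have "\<psi> \<in> \<D>"
    using A_domain assms(1) by blast
  then have "(\<psi>, v) \<in> sandwich F J"
    using perturbation_imp_sandwich assms hv by blast
  \<comment> \<open>The intermediate vector in the product is the value of \<open>F\<close> at
    \<open>\<psi>\<close>, which is \<open>u\<close>.\<close>
  then have Ju: "(J u, v) \<in> adj F"
    using linear_operator_unique[OF rigging(1) _ assms(4)] unfolding sandwich_iff by blast
  obtain a b where a: "(v, a) \<in> resolvent ?H ?z" "(a, b) \<in> F"
    using resolvent_exists[OF HA, of ?z v] assms(3) by auto
  have b: "b = T_op F ?H ?z (J u)"
    using T_op_eq[OF HA _ Ju a] assms(3) by simp
  obtain c d where c: "(\<psi>, c) \<in> resolvent ?H ?z" "(c, d) \<in> F"
    using resolvent_exists[OF HA, of ?z \<psi>] assms(3) by auto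
  define t where "t = complex_of_real (s - r)"
  define k where "k = \<i> * of_real y"
  have a': "(a, v + ?z *\<^sub>C a) \<in> ?H" and c': "(c, \<psi> + ?z *\<^sub>C c) \<in> ?H"
    using a c by (simp_all add: resolvent_iff)
  have \<psi>H: "(\<psi>, h + complex_of_real r *\<^sub>C v) \<in> ?H"
    using hv unfolding H_line_def op_plus_def op_scale_def by blast
  text \<open>\<open>e = \<psi> + t R\<^sub>z v + iy R\<^sub>z \<psi>\<close> solves \<open>(H - z) e = 0\<close>, so it vanishes.\<close>
  define e where "e = \<psi> - (- t) *\<^sub>C a - (- k) *\<^sub>C c"
  have "(e, h + complex_of_real r *\<^sub>C v - (- t) *\<^sub>C (v + ?z *\<^sub>C a)
      - (- k) *\<^sub>C (\<psi> + ?z *\<^sub>C c)) \<in> ?H"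
    unfolding e_def by (intro linear_operator_diff_scaleC lin \<psi>H a' c')
  moreover have "h + complex_of_real r *\<^sub>C v - (- t) *\<^sub>C (v + ?z *\<^sub>C a)
      - (- k) *\<^sub>C (\<psi> + ?z *\<^sub>C c) = ?z *\<^sub>C e"
  proof -
    have h: "h = complex_of_real l *\<^sub>C \<psi> - complex_of_real s *\<^sub>C v"
      using hv(3) by simp
    have z: "?z *\<^sub>C \<psi> = complex_of_real l *\<^sub>C \<psi> + k *\<^sub>C \<psi>"
      by (simp add: k_def Complex_eq flip: scaleC_add_left)
    have s: "complex_of_real s *\<^sub>C v = complex_of_real r *\<^sub>C v + t *\<^sub>C v"
      by (simp add: t_def flip: scaleC_add_left)
    have "?z *\<^sub>C e = ?z *\<^sub>C \<psi> + t *\<^sub>C ?z *\<^sub>C a + k *\<^sub>C ?z *\<^sub>C c"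
      by (simp add: e_def scaleC_minus_left scaleC_add_right scaleC_scaleC mult.commute)
    then show ?thesis
      unfolding h z s by (simp add: scaleC_minus_left scaleC_add_right)
  qed
  ultimately have eH: "(e, ?z *\<^sub>C e) \<in> ?H"
    by simp
  \<comment> \<open>A symmetric operator has no non-real eigenvalue: the imaginary parts give
    \<open>y * (norm e)\<^sup>2 = 0\<close>.\<close>
  have "cnj ?z * cinner e e = ?z * cinner e e"
    using self_adjoint_symmetric[OF A_self_adjoint[OF HA] eH eH]
    by (simp only: cinner_scaleC_left cinner_scaleC_right)
  then have "Im (cnj ?z * cinner e e) = Im (?z * cinner e e)"
    by (rule arg_cong)
  then have "e = 0"
    using assms(3) by (simp add: cinner_self)
  \<comment> \<open>Applying \<open>F\<close> to \<open>e = 0\<close> turns the vector identity in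
    the first space into the desired one in the second.\<close>
  moreover have "(e, u - (- t) *\<^sub>C b - (- k) *\<^sub>C d) \<in> F"
    unfolding e_def by (intro linear_operator_diff_scaleC rigging(1) assms(4) a(2) c(2))
  moreover have "(0, 0) \<in> F"
    using rigging(1) unfolding linear_operator_def by blast
  ultimately have "u - (- t) *\<^sub>C b - (- k) *\<^sub>C d = 0"
    using linear_operator_unique rigging(1) by blast
  then have "u + t *\<^sub>C b + k *\<^sub>C d = 0"
    by (simp add: scaleC_minus_left)
  then have "u + (s - r) *\<^sub>R b = - ((\<i> * of_real y) *\<^sub>C d)"
    by (simp add: scaleR_scaleC t_def k_def eq_neg_iff_add_eq_0)
  with c b that show ?thesis
    by blast
qed

end

section \<open>Passage to the limit on the real axis\<close>

theorem theorem1p22: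
  fixes F :: "('h::chilbert_space, 'k::chilbert_space) graph"
    and \<J> :: "('k \<Rightarrow>\<^sub>L 'k) set"
    and \<A> :: "('h, 'h) graph set"
    and \<D> :: "'h set"
    and H\<^sub>0 V :: "('h, 'h) graph"
    and J :: "'k \<Rightarrow>\<^sub>L 'k"
    and l r\<^sub>l r :: real
    and \<psi> :: 'h
    and u :: 'k
  assumes "rigged_affine_space F \<J> \<A> \<D>"
    and "essentially_regular F \<A> l"
    and "H\<^sub>0 \<in> \<A>" and "l \<in> regular_points F H\<^sub>0"
    and "J \<in> \<J>" and "V = perturbation F J"
    and "resonance_point_of_triple F l H\<^sub>0 V r\<^sub>l"
    and "regular_point_of_triple F l H\<^sub>0 V r"
    and "eigenvector (H_line H\<^sub>0 V r\<^sub>l) (complex_of_real l) \<psi>" and "\<psi> \<in> \<D>"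
    and "(\<psi>, u) \<in> F"
  shows "u \<noteq> 0 \<and>
    blinfun_apply (id_blinfun + (r\<^sub>l - r) *\<^sub>R (T_limit F (H_line H\<^sub>0 V r) l o\<^sub>L J)) u = 0"
proof
  interpret rigged_affine_space F \<J> \<A> \<D>
    by fact
  let ?H = "H_line H\<^sub>0 V r"
  let ?T = "\<lambda>y. T_op F ?H (Complex l y)"
  have HA: "?H \<in> \<A>"
    using H_line_in_affine_space assms by blast
  have eig: "(\<psi>, complex_of_real l *\<^sub>C \<psi>) \<in> H_line H\<^sub>0 V r\<^sub>l" and "\<psi> \<noteq> 0"
    using assms(9) unfolding eigenvector_def by blast+
  then show "u \<noteq> 0"
    using rigging(4) assms(11) unfolding kernel_def by blast
  obtain L where L: "(?T \<longlongrightarrow> L) (at_right 0)"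
    using assms(8) unfolding regular_point_of_triple_def regular_points_def by blast
  then have T_limit: "T_limit F ?H l = L"
    unfolding T_limit_def by (intro tendsto_Lim) auto
  define U where "U y = u + (r\<^sub>l - r) *\<^sub>R ?T y (J u)" for y
  \<comment> \<open>Weak testing against the domain of \<open>adj F\<close> suffices because only
    zero is orthogonal to it. Both limits of \<open>cinner g (U y)\<close> are computed and
    compared.\<close>
  have "cinner g (u + (r\<^sub>l - r) *\<^sub>R L (J u)) = 0" if g: "g \<in> Domain (adj F)" for g
  proof (rule tendsto_unique)
    show "((\<lambda>y. cinner g (U y)) \<longlongrightarrow> cinner g (u + (r\<^sub>l - r) *\<^sub>R L (J u))) (at_right 0)"
      unfolding U_def by (intro tendsto_cinner_left tendsto_intros L)
    have bound: "cmod (cinner g (U y)) \<le> norm \<psi> * sqrt (y * norm (?T y)) * norm g"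
      if y: "y > 0" for y
    proof -
      obtain c d where cd: "(\<psi>, c) \<in> resolvent ?H (Complex l y)" "(c, d) \<in> F"
        "U y = - ((\<i> * of_real y) *\<^sub>C d)"
        using eigenvector_resolvent_identity[OF assms(3,5) y assms(11) eig[unfolded assms(6)]]
        unfolding U_def assms(6) by blast
      then have "cmod (cinner g (U y)) = y * cmod (cinner g d)"
        using y by (simp add: cinner_minus_right cinner_scaleC_right norm_mult)
      then show ?thesis
        using weak_resolvent_bound[OF HA y g cd(1,2)] by simp
    qed
    show "((\<lambda>y. cinner g (U y)) \<longlongrightarrow> 0) (at_right 0)"
    proof (rule Lim_null_comparison)
      show "\<forall>\<^sub>F y in at_right 0. cmod (cinner g (U y)) \<le> norm \<psi> * sqrt (y * norm (?T y)) * norm g"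
        using eventually_at_right_less[of 0] by (rule eventually_mono) (rule bound)
      \<comment> \<open>Convergence of \<open>?T\<close> keeps its norm bounded near 0, so the
        factor \<open>y\<close> under the root drives the bound to zero.\<close>
      have "((\<lambda>y. norm \<psi> * sqrt (y * norm (?T y)) * norm g)
          \<longlongrightarrow> norm \<psi> * sqrt (0 * norm L) * norm g) (at_right 0)"
        by (intro tendsto_intros L)
      then show "((\<lambda>y. norm \<psi> * sqrt (y * norm (?T y)) * norm g) \<longlongrightarrow> 0) (at_right 0)"
        by simp
    qed
  qed (rule trivial_limit_at_right_real)
  then have "u + (r\<^sub>l - r) *\<^sub>R L (J u) = 0"
    using orthogonal_Domain_adj_eq_zero rigging(1,2) by blast
  then show "blinfun_apply (id_blinfun + (r\<^sub>l - r) *\<^sub>R (T_limit F ?H l o\<^sub>L J)) u = 0"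
    by (simp add: T_limit blinfun.add_left blinfun.scaleR_left)
qed

end
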